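(* Let $G(s)$ and $\tau>0$ be the delay-free plant and input delay described in the context, and let $\omega_1,\dots,\omega_k>0$ be the targeted frequencies. Let $\omega_b>0$ be a base frequency, i.e. $\omega_b\le\omega_i$ and $\omega_i/\omega_b\in\mathbb{Z}$ for all $i=1,\dots,k$. Let $$z(s)=s\prod_{i=1}^k(s^2+\omega_i^2)\prod_{i=1}^m(s-z_i),\qquad p(s)=\prod_{i=1}^n(s-p_i),$$ with $z_i\in\mathbb{C}$ and $p_i\in\mathbb{C}^-$ (the open left half-plane), be the numerator and denominator of the reference sensitivity $S_{\mathrm{ref}}(s)=z(s)/p(s)$. Consider the Internal Model Control scheme in the ideal configuration, with controller $Q(s)e^{-s\theta}$, where $Q(s)=\frac{1}{G(s)}F(s)$ and $$F(s)=\frac{p(s)-z(s)}{p(s)}.$$ If the controller delay is $$\theta=\frac{2\pi l_b}{\omega_b}-\tau\ \ge 0,\qquad l_b=\left\lfloor\frac{\tau\omega_b}{2\pi}\right\rfloor+1,$$ then the ideal sensitivity $S(s)=1-Q(s)G(s)e^{-s(\tau+\theta)}$ satisfies $$S(0)=S(\mathrm{j}\omega_i)=0,\qquad i=1,\dots,k.$$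
   Context: Plant: $G_\tau(s)=G(s)e^{-s\tau}$ with delay $\tau>0$ and $$G(s)=\frac{a_\alpha s^\alpha+\dots+a_1s+a_0}{b_\beta s^\beta+\dots+b_1s+b_0},\qquad \beta\ge\alpha,\ \alpha,\beta\in\mathbb{N},$$ where numerator and denominator are Hurwitz polynomials (so $G$ is stable, proper and minimum phase). Internal Model Control (IMC) scheme: the true system is $G_s(s)e^{-s\tau_s}$, its model is $G_m(s)e^{-s\tau_m}$, the controller is $Q(s)e^{-s\theta}$. With reference $r$, output disturbance $d$, control input $u$, output $y$: $y=G_se^{-s\tau_s}u+d$, $y_m=G_me^{-s\tau_m}u$, $u=Qe^{-s\theta}\bigl(r-(y-y_m)\bigr)$ (in the Laplace domain). The sensitivity is $S(s)=Y(s)/D(s)$, where $Y(s)$ and $D(s)$ are the Laplace transforms of $y$ and $d$ (with $r=0$). The ideal configuration means $G_s=G_m=G$ and $\tau_s=\tau_m=\tau$; then $S(s)=1-Q(s)G(s)e^{-s(\tau+\theta)}$. Here $\mathrm{j}$ is the imaginary unit. *)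

theory Defs
  imports Complex_Main "HOL-Computational_Algebra.Polynomial"
begin

definition hurwitz :: "complex poly \<Rightarrow> bool" where
  "hurwitz q \<longleftrightarrow> q \<noteq> 0 \<and> (\<forall>s. poly q s = 0 \<longrightarrow> Re s < 0)"

definition plant_data :: "complex poly \<Rightarrow> complex poly \<Rightarrow> bool" where
  "plant_data a b \<longleftrightarrow> degree a \<le> degree b \<and> hurwitz a \<and> hurwitz b"

definition plant :: "complex poly \<Rightarrow> complex poly \<Rightarrow> complex \<Rightarrow> complex" where
  "plant a b s = poly a s / poly b s"

definition delay :: "real \<Rightarrow> complex \<Rightarrow> complex" where
  "delay \<tau> s = exp (- s * complex_of_real \<tau>)"

(* The loop equations at the complex frequency s. The signals R, D, U, Y, Ym are the Laplace
   transforms of reference, output disturbance, control input, output and model output. *)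
definition imc_loop ::
  "(complex \<Rightarrow> complex) \<Rightarrow> real \<Rightarrow> (complex \<Rightarrow> complex) \<Rightarrow> real \<Rightarrow> (complex \<Rightarrow> complex) \<Rightarrow> real \<Rightarrow>
   (complex \<Rightarrow> complex) \<Rightarrow> (complex \<Rightarrow> complex) \<Rightarrow> (complex \<Rightarrow> complex) \<Rightarrow>
   (complex \<Rightarrow> complex) \<Rightarrow> (complex \<Rightarrow> complex) \<Rightarrow> complex \<Rightarrow> bool" where
  "imc_loop Gs \<tau>s Gm \<tau>m Q \<theta> R D U Y Ym s \<longleftrightarrow>
     Y s = Gs s * delay \<tau>s s * U s + D s \<and>
     Ym s = Gm s * delay \<tau>m s * U s \<and>
     U s = Q s * delay \<theta> s * (R s - (Y s - Ym s))"

(* Y(s)/D(s) for zero reference. The ratio does not depend on the choice of the disturbance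
   whenever the loop equations determine Y from D, as they always do if model and system
   coincide. *)
definition imc_sensitivity ::
  "(complex \<Rightarrow> complex) \<Rightarrow> real \<Rightarrow> (complex \<Rightarrow> complex) \<Rightarrow> real \<Rightarrow> (complex \<Rightarrow> complex) \<Rightarrow> real \<Rightarrow>
   complex \<Rightarrow> complex" where
  "imc_sensitivity Gs \<tau>s Gm \<tau>m Q \<theta> s =
     (THE \<sigma>. \<exists>D U Y Ym. imc_loop Gs \<tau>s Gm \<tau>m Q \<theta> (\<lambda>_. 0) D U Y Ym s \<and>
                D s \<noteq> 0 \<and> \<sigma> = Y s / D s)"

definition ref_num :: "nat \<Rightarrow> (nat \<Rightarrow> real) \<Rightarrow> nat \<Rightarrow> (nat \<Rightarrow> complex) \<Rightarrow> complex \<Rightarrow> complex" where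
  "ref_num k \<omega> m z s =
     s * (\<Prod>i=1..k. s\<^sup>2 + (complex_of_real (\<omega> i))\<^sup>2) * (\<Prod>i=1..m. s - z i)"

definition ref_den :: "nat \<Rightarrow> (nat \<Rightarrow> complex) \<Rightarrow> complex \<Rightarrow> complex" where
  "ref_den n p s = (\<Prod>i=1..n. s - p i)"

end

theory Submission imports Defs begin

text \<open>With a perfect model the feedback signal \<open>y - y\<^sub>m\<close> is just \<open>d\<close>, so there is no actual loop and
  the sensitivity has a closed form. The controller delay completes the total delay to \<open>l\<^sub>b\<close> base periods
  \<open>2 * pi / \<omega>\<^sub>b\<close>, so the delay factor is 1 at every multiple of \<open>\<i> * \<omega>\<^sub>b\<close>. At 0 and at the targeted
  frequencies \<open>z\<close> also vanishes, hence \<open>Q * G = F = 1\<close> there; no division by zero occurs, because all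
  zeros of the plant's polynomials and of \<open>p\<close> lie in the open left half-plane.\<close>

text \<open>The loop equations are purely algebraic at a fixed \<open>s\<close>, so \<open>G\<close>
  and \<open>Q\<close> may be arbitrary functions. Evaluating \<open>THE\<close> takes two facts:
  all admissible signals give the same ratio, and some admissible signals exist.\<close>

lemma imc_sensitivity_ideal:
  "imc_sensitivity G \<tau> G \<tau> Q \<theta> s = 1 - Q s * G s * exp (- s * complex_of_real (\<tau> + \<theta>))"
proof -
  let ?\<sigma> = "1 - Q s * G s * (delay \<tau> s * delay \<theta> s)"
  have unique: "Y s / D s = ?\<sigma>"
    if loop: "imc_loop G \<tau> G \<tau> Q \<theta> (\<lambda>_. 0) D U Y Ym s" and "D s \<noteq> 0" for D U Y Ym
  proof -
    from loop have Y: "Y s = G s * delay \<tau> s * U s + D s" and Ym: "Ym s = G s * delay \<tau> s * U s"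
      and fb: "U s = Q s * delay \<theta> s * (0 - (Y s - Ym s))"
      unfolding imc_loop_def by blast+
    have "Y s - Ym s = D s"
      unfolding Y Ym by simp
    with fb have U: "U s = Q s * delay \<theta> s * (- D s)"
      by (simp only: diff_0)
    have "Y s = D s * ?\<sigma>"
      unfolding Y U by (simp add: ring_distribs)
    then show ?thesis
      using \<open>D s \<noteq> 0\<close> by simp
  qed
  \<comment> \<open>Unit disturbance: the feedback signal \<open>Y s - Ym s\<close> is then 1, which
    forces \<open>U s = - Q s * delay \<theta> s\<close> and hence \<open>Y\<close> and
    \<open>Ym\<close>.\<close>
  have witness: "imc_loop G \<tau> G \<tau> Q \<theta> (\<lambda>_. 0) (\<lambda>_. 1) (\<lambda>_. - Q s * delay \<theta> s)
      (\<lambda>_. ?\<sigma>) (\<lambda>_. ?\<sigma> - 1) s"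
    unfolding imc_loop_def by (simp add: algebra_simps)
  have exist: "\<exists>D U Y Ym. imc_loop G \<tau> G \<tau> Q \<theta> (\<lambda>_. 0) D U Y Ym s \<and> D s \<noteq> 0 \<and> ?\<sigma> = Y s / D s"
    by (intro exI conjI, rule witness) simp_all
  have "imc_sensitivity G \<tau> G \<tau> Q \<theta> s = ?\<sigma>"
    unfolding imc_sensitivity_def
  proof (rule the_equality, rule exist)
    fix \<sigma>
    assume "\<exists>D U Y Ym. imc_loop G \<tau> G \<tau> Q \<theta> (\<lambda>_. 0) D U Y Ym s \<and> D s \<noteq> 0 \<and> \<sigma> = Y s / D s"
    then show "\<sigma> = ?\<sigma>"
      using unique by blast
  qed
  moreover have "delay \<tau> s * delay \<theta> s = exp (- s * complex_of_real (\<tau> + \<theta>))"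
    unfolding delay_def exp_add[symmetric] of_real_add distrib_left ..
  ultimately show ?thesis by simp
qed

lemma ref_den_nonzero:
  assumes "\<And>i. i \<in> {1..n} \<Longrightarrow> Re (p i) < 0" and "Re s \<ge> 0"
  shows "ref_den n p s \<noteq> 0"
  using assms by (force simp: ref_den_def)

lemma plant_nonzero:
  assumes "plant_data a b" and "Re s \<ge> 0"
  shows "plant a b s \<noteq> 0"
  using assms by (fastforce simp: plant_data_def hurwitz_def plant_def)

lemma ref_num_0: "ref_num k \<omega> m z 0 = 0"
  by (simp add: ref_num_def)

text \<open>The factor with index \<open>i\<close> vanishes, since the square of
  \<open>\<i> * \<omega> i\<close> is minus the square of \<open>\<omega> i\<close>.\<close>

lemma ref_num_freq:
  assumes "i \<in> {1..k}"
  shows "ref_num k \<omega> m z (\<i> * complex_of_real (\<omega> i)) = 0"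
proof -
  have "(\<Prod>j=1..k. (\<i> * complex_of_real (\<omega> i))\<^sup>2 + (complex_of_real (\<omega> j))\<^sup>2) = 0"
    using assms by (intro prod_zero bexI[of _ i]) (auto simp: power_mult_distrib)
  then show ?thesis by (simp add: ref_num_def)
qed

text \<open>With \<open>w = N * w0\<close> the exponent is \<open>-2 * pi * \<i> * l * N\<close>, a
  period of \<open>exp\<close>. For \<open>w0 = 0\<close> both quotients are 0 by convention and the
  exponent is 0.\<close>

lemma exp_harmonic_eq_1:
  assumes "w / w0 \<in> \<int>"
  shows "exp (- (\<i> * complex_of_real w) * complex_of_real (2 * pi * of_int l / w0)) = 1"
proof -
  obtain N where N: "w / w0 = of_int N"
    using assms by (auto elim: Ints_cases)
  have "w * (2 * pi * of_int l / w0) = 2 * pi * of_int l * (w / w0)"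
    by simp
  \<comment> \<open>The sign is moved into the integer, so that the minus of the delay exponent
    cancels and \<open>cis\<close> of a multiple of \<open>2 * pi\<close> remains.\<close>
  also have "\<dots> = - (2 * pi * of_int (- (l * N)))"
    unfolding N by simp
  finally have "- (\<i> * complex_of_real w) * complex_of_real (2 * pi * of_int l / w0)
      = \<i> * complex_of_real (2 * pi * of_int (- (l * N)))"
    by (metis (no_types) minus_minus mult.assoc mult_minus_left mult_minus_right of_real_minus of_real_mult)
  then have "exp (- (\<i> * complex_of_real w) * complex_of_real (2 * pi * of_int l / w0))
      = cis (2 * pi * of_int (- (l * N)))"
    by (simp only: cis_conv_exp)
  also have "\<dots> = 1"
    by (rule cis_multiple_2pi) simp
  finally show ?thesis .
qed

theorem proposition2:
  fixes a b :: "complex poly" and \<tau> \<omega>\<^sub>b \<theta> :: real and l\<^sub>b :: int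
    and k m n :: nat and \<omega> :: "nat \<Rightarrow> real" and zs ps :: "nat \<Rightarrow> complex"
    and G z p F Q S :: "complex \<Rightarrow> complex"
  assumes plant: "plant_data a b" "G = plant a b"
    and delay_pos: "\<tau> > 0"
    and freqs: "\<And>i. i \<in> {1..k} \<Longrightarrow> \<omega> i > 0"
    and base: "\<omega>\<^sub>b > 0"
      "\<And>i. i \<in> {1..k} \<Longrightarrow> \<omega>\<^sub>b \<le> \<omega> i"
      "\<And>i. i \<in> {1..k} \<Longrightarrow> \<omega> i / \<omega>\<^sub>b \<in> \<int>"
    and num: "z = ref_num k \<omega> m zs"
    and den: "p = ref_den n ps" "\<And>i. i \<in> {1..n} \<Longrightarrow> Re (ps i) < 0"
    and F: "\<And>s. F s = (p s - z s) / p s"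
    and Q: "\<And>s. Q s = 1 / G s * F s"
    and ctrl_delay: "l\<^sub>b = \<lfloor>\<tau> * \<omega>\<^sub>b / (2 * pi)\<rfloor> + 1"
      "\<theta> = 2 * pi * of_int l\<^sub>b / \<omega>\<^sub>b - \<tau>"
    and sens: "S = imc_sensitivity G \<tau> G \<tau> Q \<theta>"
  shows "\<theta> \<ge> 0 \<and>
    (\<forall>s. poly a s \<noteq> 0 \<longrightarrow> poly b s \<noteq> 0 \<longrightarrow> p s \<noteq> 0 \<longrightarrow>
       S s = 1 - Q s * G s * exp (- s * complex_of_real (\<tau> + \<theta>))) \<and>
    S 0 = 0 \<and> (\<forall>i\<in>{1..k}. S (\<i> * complex_of_real (\<omega> i)) = 0)"
proof -
  have \<tau>\<theta>: "\<tau> + \<theta> = 2 * pi * of_int l\<^sub>b / \<omega>\<^sub>b"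
    using ctrl_delay(2) by simp
  \<comment> \<open>Floor plus one bounds its argument from above: \<open>l\<^sub>b\<close> base
    periods last at least \<open>\<tau>\<close>, which makes the controller delay causal.\<close>
  have "\<tau> * \<omega>\<^sub>b / (2 * pi) \<le> of_int l\<^sub>b"
    unfolding ctrl_delay(1) by linarith
  then have nonneg: "\<theta> \<ge> 0"
    unfolding ctrl_delay(2) using base(1) by (simp add: field_simps)
  have S: "S s = 1 - Q s * G s * exp (- s * complex_of_real (\<tau> + \<theta>))" for s
    unfolding sens by (rule imc_sensitivity_ideal)
  have zero: "S s = 0"
    if "Re s \<ge> 0" "z s = 0" "exp (- s * complex_of_real (\<tau> + \<theta>)) = 1" for s
    unfolding S Q F using that plant_nonzero[OF plant(1), of s] ref_den_nonzero[of n ps s] den plant(2)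
    by simp
  \<comment> \<open>At 0 the delay factor is \<open>exp 0\<close>, whatever the total delay.\<close>
  have S_0: "S 0 = 0"
    by (rule zero) (simp_all add: num ref_num_0)
  have S_freq: "S (\<i> * complex_of_real (\<omega> i)) = 0" if "i \<in> {1..k}" for i
    by (rule zero) (use that in \<open>simp_all only: num ref_num_freq \<tau>\<theta> exp_harmonic_eq_1 base(3)\<close>, simp)
  show ?thesis
    using nonneg S S_0 S_freq by blast
qed

end
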